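(* Let $n\le m$, let $B\in\mathbb{Q}^{n\times m}$ have rank $n$, let $R_w\in\mathbb{R}^{n\times n}$ and $R_u\in\mathbb{R}^{m\times m}$ be symmetric positive definite, and let $\mathcal W=\{w\in\mathbb{R}^n: w^TR_ww\le 1\}$, $\mathcal U=\{u\in\mathbb{R}^m: u^TR_uu\le 1\}$. Let $\Phi$ be the $n\times n$ matrix associated with $B$ and $R_u$ defined in the context. Then the system $\dot x(t)=Bu(t)-w(t)$, with $w(t)\in\mathcal W$ and $u(t)\in\mathcal U$, is $\varepsilon$-stabilizable if and only if $w^{*T}\Phi w^*<1$ for every eigenvector $w^*$ of $R_w^{-1}\Phi$ associated with the maximum eigenvalue of $R_w^{-1}\Phi$ and normalized so that $w^{*T}R_ww^*=1$.
   Context: Here $x(t)\in\mathbb{R}^n$ is the vector of buffer levels, $u(t)\in\mathbb{R}^m$ the control and $w(t)\in\mathbb{R}^n$ the unknown demand. The system is called $\varepsilon$-stabilizable when for every $w\in\mathcal W$ there exists $u\in\mathrm{int}(\mathcal U)$ such that $Bu=w$. Definition of $\Phi$. Order the columns of $B$ (and correspondingly the components of $u$, hence the rows and columns of $R_u$) so that $B=[\mathcal B\,|\,N]$ with $\mathcal B\in\mathbb{R}^{n\times n}$ invertible and $N\in\mathbb{R}^{n\times(m-n)}$ the remaining columns. Let $$M=\left([-N^T\mathcal B^{-T}\,|\,I]\,R_u\begin{bmatrix}-\mathcal B^{-1}N\\ I\end{bmatrix}\right)^{-1}[-N^T\mathcal B^{-T}\,|\,I]\,R_u\begin{bmatrix}\mathcal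 B^{-1}\\ 0\end{bmatrix}\in\mathbb{R}^{(m-n)\times n},$$ where $I$ is the $(m-n)\times(m-n)$ identity and $0$ the $(m-n)\times n$ zero matrix, and $$H=\begin{bmatrix}\mathcal B^{-1}+\mathcal B^{-1}NM\\ -M\end{bmatrix}\in\mathbb{R}^{m\times n},\qquad \Phi=H^TR_uH.$$ If $m=n$, then $N$ and $M$ are empty and $H=B^{-1}$. *)

theory Defs
  imports
    "Jordan_Normal_Form.Gauss_Jordan_Elimination"
    "Jordan_Normal_Form.Spectral_Radius"
    "Jordan_Normal_Form.DL_Rank"
    "HOL-Combinatorics.Permutations"
begin

definition quad_form :: "real mat \<Rightarrow> real vec \<Rightarrow> real" where
  "quad_form R v = v \<bullet> (R *\<^sub>v v)"

definition sym_pos_def :: "nat \<Rightarrow> real mat \<Rightarrow> bool" where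
  "sym_pos_def n R \<longleftrightarrow> R \<in> carrier_mat n n \<and> R\<^sup>T = R \<and>
     (\<forall>v\<in>carrier_vec n. v \<noteq> 0\<^sub>v n \<longrightarrow> quad_form R v > 0)"

definition ellipsoid :: "nat \<Rightarrow> real mat \<Rightarrow> real vec set" where
  "ellipsoid n R = {v \<in> carrier_vec n. quad_form R v \<le> 1}"

text \<open>The type of vectors contains all dimensions at once and carries no topology, so the
  Euclidean interior of a subset of the \<open>n\<close>-dimensional space is spelled out with balls.\<close>

definition interior_vec :: "nat \<Rightarrow> real vec set \<Rightarrow> real vec set" where
  "interior_vec n S = {u \<in> carrier_vec n.
     \<exists>e>0. \<forall>v\<in>carrier_vec n. sqrt ((v - u) \<bullet> (v - u)) < e \<longrightarrow> v \<in> S}"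

text \<open>Property of the system \<open>x'(t) = B u(t) - w(t)\<close> with \<open>w(t) \<in> W\<close> and \<open>u(t) \<in> U\<close>;
  the controls live in the space of dimension \<open>dim_col B\<close>.\<close>

definition eps_stabilizable :: "real mat \<Rightarrow> real vec set \<Rightarrow> real vec set \<Rightarrow> bool" where
  "eps_stabilizable B W U \<longleftrightarrow> (\<forall>w\<in>W. \<exists>u\<in>interior_vec (dim_col B) U. B *\<^sub>v u = w)"

text \<open>\<open>mat_inverse\<close> returns \<open>None\<close> exactly on non-invertible arguments, where the value of
  \<open>inv_mat\<close> is unspecified.\<close>

definition inv_mat :: "real mat \<Rightarrow> real mat" where
  "inv_mat A = the (mat_inverse A)"

definition append_cols :: "real mat \<Rightarrow> real mat \<Rightarrow> real mat" where
  "append_cols A B = four_block_mat A B (0\<^sub>m 0 (dim_col A)) (0\<^sub>m 0 (dim_col B))"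

text \<open>Reordering the control components by \<open>p\<close>: position \<open>j\<close> is taken by the old component
  \<open>p j\<close>.\<close>

definition reorder_cols :: "(nat \<Rightarrow> nat) \<Rightarrow> real mat \<Rightarrow> real mat" where
  "reorder_cols p B = mat (dim_row B) (dim_col B) (\<lambda>(i, j). B $$ (i, p j))"

definition reorder_rows_cols :: "(nat \<Rightarrow> nat) \<Rightarrow> real mat \<Rightarrow> real mat" where
  "reorder_rows_cols p R = mat (dim_row R) (dim_col R) (\<lambda>(i, j). R $$ (p i, p j))"

text \<open>The splitting \<open>B = [basic_part B | nonbasic_part B]\<close>.\<close>

definition basic_part :: "real mat \<Rightarrow> real mat" where
  "basic_part B = mat (dim_row B) (dim_row B) (\<lambda>(i, j). B $$ (i, j))"

definition nonbasic_part :: "real mat \<Rightarrow> real mat" where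
  "nonbasic_part B =
     mat (dim_row B) (dim_col B - dim_row B) (\<lambda>(i, j). B $$ (i, dim_row B + j))"

definition M_mat :: "real mat \<Rightarrow> real mat \<Rightarrow> real mat" where
  "M_mat B R = (let n = dim_row B; k = dim_col B - dim_row B;
       Bi = inv_mat (basic_part B); N = nonbasic_part B;
       L = append_cols (- (N\<^sup>T * Bi\<^sup>T)) (1\<^sub>m k)
     in inv_mat (L * R * (- (Bi * N) @\<^sub>r 1\<^sub>m k)) * (L * R * (Bi @\<^sub>r 0\<^sub>m k n)))"

definition H_mat :: "real mat \<Rightarrow> real mat \<Rightarrow> real mat" where
  "H_mat B R = (let Bi = inv_mat (basic_part B); N = nonbasic_part B; M = M_mat B R
     in (Bi + Bi * N * M) @\<^sub>r (- M))"

definition Phi_mat :: "real mat \<Rightarrow> real mat \<Rightarrow> real mat" where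
  "Phi_mat B R = (H_mat B R)\<^sup>T * R * H_mat B R"

definition admissible_order :: "real mat \<Rightarrow> (nat \<Rightarrow> nat) \<Rightarrow> bool" where
  "admissible_order B p \<longleftrightarrow>
     p permutes {..<dim_col B} \<and> invertible_mat (basic_part (reorder_cols p B))"

text \<open>Full row rank guarantees that the reordering used for \<open>Phi_mat\<close> is possible.\<close>

lemma admissible_order_exists:
  assumes B: "B \<in> carrier_mat n m" and rk: "vec_space.rank n B = n"
  shows "\<exists>p. admissible_order B p"
proof -
  interpret vec_space "TYPE(real)" n .
  have "lin_indpt {}"
    using finite_lin_indpt2[of "{}"] by auto
  then obtain S where S: "maximal S (\<lambda>T. T \<subseteq> set (cols B) \<and> lin_indpt T)"
    using maximal_exists_superset[of "set (cols B)" "\<lambda>T. T \<subseteq> set (cols B) \<and> lin_indpt T" "{}"]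
    by auto
  have sub: "S \<subseteq> set (cols B)" and li: "lin_indpt S"
    using S unfolding maximal_def by auto
  have cardS: "card S = n"
    using rank_card_indpt[OF B S] rk by simp
  have "finite S"
    using sub finite_subset by blast
  then obtain xs where xs: "set xs = S" "distinct xs"
    using finite_distinct_list by blast
  have len: "length xs = n"
    using xs cardS distinct_card by fastforce
  have "\<forall>i\<in>{..<n}. \<exists>k. k < m \<and> col B k = xs ! i"
  proof
    fix i assume "i \<in> {..<n}"
    then have "xs ! i \<in> set (cols B)"
      using sub xs len nth_mem by (metis lessThan_iff subsetD)
    then obtain k where "k < length (cols B)" "cols B ! k = xs ! i"
      by (metis in_set_conv_nth)
    then show "\<exists>k. k < m \<and> col B k = xs ! i"
      using B by (intro exI[of _ k]) auto
  qed
  then obtain f where f: "\<And>i. i < n \<Longrightarrow> f i < m \<and> col B (f i) = xs ! i"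
    using bchoice[of "{..<n}" "\<lambda>i k. k < m \<and> col B k = xs ! i"] by auto
  have inj: "inj_on f {..<n}"
  proof (rule inj_onI)
    fix i j assume ij: "i \<in> {..<n}" "j \<in> {..<n}" "f i = f j"
    then have "xs ! i = xs ! j"
      using f[of i] f[of j] by simp
    then show "i = j"
      using ij xs(2) len by (simp add: nth_eq_iff_index_eq)
  qed
  have fim: "f ` {..<n} \<subseteq> {..<m}"
    using f by auto
  have nm: "n \<le> m"
    using card_mono[OF _ fim] card_image[OF inj] by simp
  have "card ({..<m} - {..<n}) = card ({..<m} - f ` {..<n})"
    using nm fim card_image[OF inj] by (simp add: card_Diff_subset)
  then have "\<exists>g. bij_betw g ({..<m} - {..<n}) ({..<m} - f ` {..<n})"
    by (intro finite_same_card_bij) auto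
  then obtain g where g: "bij_betw g ({..<m} - {..<n}) ({..<m} - f ` {..<n})" ..
  define p where "p i = (if i < n then f i else if i < m then g i else i)" for i
  have "bij_betw p {..<n} (f ` {..<n})"
    using inj unfolding bij_betw_def p_def by (auto simp: inj_on_def)
  moreover have "bij_betw p ({..<m} - {..<n}) ({..<m} - f ` {..<n})"
    using g by (subst bij_betw_cong[of _ _ g]) (auto simp: p_def)
  ultimately have "bij_betw p ({..<n} \<union> ({..<m} - {..<n})) (f ` {..<n} \<union> ({..<m} - f ` {..<n}))"
    by (intro bij_betw_combine) auto
  moreover have "{..<n} \<union> ({..<m} - {..<n}) = {..<m}" "f ` {..<n} \<union> ({..<m} - f ` {..<n}) = {..<m}"
    using nm fim by auto
  ultimately have "bij_betw p {..<m} {..<m}"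
    by simp
  then have perm: "p permutes {..<m}"
    using nm by (intro bij_imp_permutes) (auto simp: p_def)
  let ?A = "basic_part (reorder_cols p B)"
  have A: "?A \<in> carrier_mat n n"
    using B by (simp add: basic_part_def reorder_cols_def)
  have "cols ?A = xs"
  proof (rule nth_equalityI)
    show "length (cols ?A) = length xs"
      using A len by simp
    fix i assume "i < length (cols ?A)"
    then have i: "i < n"
      using A by simp
    have "col ?A i = col B (f i)"
      using i nm conjunct1[OF f[OF i]] B by (intro eq_vecI) (auto simp: basic_part_def reorder_cols_def p_def)
    then show "cols ?A ! i = xs ! i"
      using f[OF i] A i by simp
  qed
  then have "rank ?A = n"
    using lin_indpt_full_rank[OF A] xs li by simp
  then have "det ?A \<noteq> 0"
    using det_zero_low_rank[OF A] by auto
  from det_non_zero_imp_unit[OF A this, unfolded Units_def, of "()"]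
  obtain C where "C \<in> carrier_mat n n" "C * ?A = 1\<^sub>m n" "?A * C = 1\<^sub>m n"
    by (auto simp: ring_mat_def)
  then have "inverts_mat ?A C" "inverts_mat C ?A"
    using A unfolding inverts_mat_def by (metis carrier_matD(1))+
  then have "invertible_mat ?A"
    using A unfolding invertible_mat_def square_mat.simps by (metis carrier_matD)
  then show ?thesis
    using perm B unfolding admissible_order_def by auto
qed

end

theory Submission
  imports Defs "HOL-Analysis.Function_Topology"
begin

text \<open>The vector \<open>H w\<close> solves \<open>B u = w\<close> and is \<open>R\<^sub>u\<close>-orthogonal to the kernel of \<open>B\<close>, hence
  it is the solution of least cost \<open>u\<^sup>T R\<^sub>u u\<close>, and this cost is \<open>w\<^sup>T \<Phi> w\<close>. As the interior
  of the ellipsoid is given by \<open>u\<^sup>T R\<^sub>u u < 1\<close>, stabilizability says that \<open>w\<^sup>T \<Phi> w < 1\<close> whenever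
  \<open>w\<^sup>T R\<^sub>w w \<le> 1\<close>. The quotient \<open>w\<^sup>T \<Phi> w / w\<^sup>T R\<^sub>w w\<close> attains its maximum, its maximisers are
  eigenvectors of \<open>R\<^sub>w\<^sup>-\<^sup>1 \<Phi>\<close>, and the maximum is the largest eigenvalue.\<close>

section \<open>Quadratic forms and positive definite matrices\<close>

text \<open>Coordinates given by a plain function \<open>f\<close> make the form a polynomial in the
  values of \<open>f\<close>. Continuity arguments and the reindexing of sums by a permutation rely
  on this shape.\<close>

lemma quad_form_vec:
  assumes "R \<in> carrier_mat n n"
  shows "quad_form R (vec n f) = (\<Sum>i<n. f i * (\<Sum>j<n. R $$ (i, j) * f j))"
  using assms by (auto simp: quad_form_def scalar_prod_def atLeast0LessThan intro!: sum.cong)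

lemma scalar_prod_self_eq_sum:
  fixes v :: "real vec"
  assumes "v \<in> carrier_vec n"
  shows "v \<bullet> v = (\<Sum>i<n. (v $ i)\<^sup>2)"
  using assms by (simp add: scalar_prod_def power2_eq_square atLeast0LessThan)

lemma scalar_prod_self_nonneg: "0 \<le> v \<bullet> v" for v :: "real vec"
  using scalar_prod_self_eq_sum[of v "dim_vec v"] by (simp add: sum_nonneg)

lemma scalar_prod_self_eq_0_iff:
  fixes v :: "real vec"
  assumes "v \<in> carrier_vec n"
  shows "v \<bullet> v = 0 \<longleftrightarrow> v = 0\<^sub>v n"
  using assms by (auto simp: scalar_prod_self_eq_sum[OF assms] sum_nonneg_eq_0_iff intro!: eq_vecI)

lemma sym_scalar_prod:
  fixes R :: "real mat"
  assumes R: "R \<in> carrier_mat n n" "R\<^sup>T = R" and u: "u \<in> carrier_vec n" and v: "v \<in> carrier_vec n"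
  shows "u \<bullet> (R *\<^sub>v v) = v \<bullet> (R *\<^sub>v u)"
proof -
  have "u \<bullet> (R *\<^sub>v v) = (R *\<^sub>v u) \<bullet> v"
    using transpose_vec_mult_scalar[OF R(1) v u] R(2) by simp
  also have "\<dots> = v \<bullet> (R *\<^sub>v u)"
    by (rule comm_scalar_prod[OF mult_mat_vec_carrier[OF R(1) u] v])
  finally show ?thesis .
qed

lemma quad_form_smult:
  assumes "R \<in> carrier_mat n n" "v \<in> carrier_vec n"
  shows "quad_form R (c \<cdot>\<^sub>v v) = c\<^sup>2 * quad_form R v"
  using assms by (simp add: quad_form_def mult_mat_vec power2_eq_square)

lemma quad_form_add:
  assumes R: "R \<in> carrier_mat n n" "R\<^sup>T = R" and u: "u \<in> carrier_vec n" and v: "v \<in> carrier_vec n"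
  shows "quad_form R (u + v) = quad_form R u + 2 * (v \<bullet> (R *\<^sub>v u)) + quad_form R v"
proof -
  have c: "R *\<^sub>v u \<in> carrier_vec n" "R *\<^sub>v v \<in> carrier_vec n"
    using R u v by auto
  have "quad_form R (u + v) = (u + v) \<bullet> (R *\<^sub>v u + R *\<^sub>v v)"
    unfolding quad_form_def mult_add_distrib_mat_vec[OF R(1) u v] ..
  also have "\<dots> = (u \<bullet> (R *\<^sub>v u) + u \<bullet> (R *\<^sub>v v)) + (v \<bullet> (R *\<^sub>v u) + v \<bullet> (R *\<^sub>v v))"
    using u v c by (simp add: add_scalar_prod_distrib[of _ n] scalar_prod_add_distrib[of _ n])
  finally show ?thesis
    using sym_scalar_prod[OF R u v] by (simp add: quad_form_def)
qed

lemma smult_mat_mult_vec: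
  fixes A :: "real mat"
  assumes "A \<in> carrier_mat r n" "v \<in> carrier_vec n"
  shows "(c \<cdot>\<^sub>m A) *\<^sub>v v = c \<cdot>\<^sub>v (A *\<^sub>v v)"
  using assms by (intro eq_vecI) (auto simp: scalar_prod_def sum_distrib_left mult.assoc)

text \<open>A zero of a semidefinite form is a minimum, so no first-order term can survive there.
  Along the line \<open>v + t y\<close> with \<open>y = S v\<close> the form equals
  \<open>2 t (y \<bullet> y) + t^2 q(y)\<close>, where \<open>q\<close> is the form of
  \<open>S\<close>; nonnegativity for small negative \<open>t\<close> forces
  \<open>y \<bullet> y = 0\<close>.\<close>

lemma psd_quad_form_zero:
  assumes S: "S \<in> carrier_mat n n" "S\<^sup>T = S"
    and psd: "\<And>x. x \<in> carrier_vec n \<Longrightarrow> 0 \<le> quad_form S x"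
    and v: "v \<in> carrier_vec n" "quad_form S v = 0"
  shows "S *\<^sub>v v = 0\<^sub>v n"
proof -
  let ?y = "S *\<^sub>v v"
  let ?a = "?y \<bullet> ?y"
  let ?b = "quad_form S ?y"
  have y: "?y \<in> carrier_vec n"
    using S v by auto
  have ineq: "0 \<le> 2 * t * ?a + t\<^sup>2 * ?b" for t
  proof -
    have ty: "t \<cdot>\<^sub>v ?y \<in> carrier_vec n"
      using y by auto
    have "0 \<le> quad_form S (v + t \<cdot>\<^sub>v ?y)"
      using psd v(1) ty by auto
    also have "\<dots> = 2 * t * ?a + t\<^sup>2 * ?b"
      using quad_form_add[OF S v(1) ty] quad_form_smult[OF S(1) y] v(2) y by simp
    finally show ?thesis .
  qed
  have b: "0 \<le> ?b"
    using psd y by auto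
  have "?a \<le> 0"
  proof (rule ccontr)
    assume "\<not> ?a \<le> 0"
    then have a: "0 < ?a"
      by simp
    \<comment> \<open>Small enough for the linear term to win at \<open>t = - s\<close>: the value
      becomes \<open>- s^2 (?b + 2)\<close>. The summand 1 keeps the denominator positive when
      \<open>?b = 0\<close>.\<close>
    define s where "s = ?a / (?b + 1)"
    have s: "0 < s" "?a = s * (?b + 1)"
      using a b by (auto simp: s_def)
    have "0 \<le> 2 * (- s) * ?a + (- s)\<^sup>2 * ?b"
      by (rule ineq)
    also have "\<dots> = s\<^sup>2 * (- 2 * (?b + 1) + ?b)"
      unfolding s(2) by (simp add: algebra_simps power2_eq_square)
    also have "\<dots> < 0"
      using s(1) b by (intro mult_pos_neg) auto
    finally show False
      by simp
  qed
  then have "?a = 0"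
    using scalar_prod_self_nonneg[of ?y] by simp
  then show ?thesis
    using scalar_prod_self_eq_0_iff[OF y] by simp
qed

lemma quad_form_spd_nonneg:
  assumes "sym_pos_def n R" "v \<in> carrier_vec n"
  shows "0 \<le> quad_form R v"
proof (cases "v = 0\<^sub>v n")
  case True
  then show ?thesis
    using assms by (auto simp: quad_form_def sym_pos_def_def)
next
  case False
  then show ?thesis
    using assms by (auto simp: sym_pos_def_def less_imp_le)
qed

section \<open>Inverses, determinants and positive definiteness\<close>

lemma inv_mat_det:
  assumes A: "A \<in> carrier_mat n n" and det: "det A \<noteq> 0"
  shows "inv_mat A \<in> carrier_mat n n" "A * inv_mat A = 1\<^sub>m n" "inv_mat A * A = 1\<^sub>m n"
proof -
  \<comment> \<open>A unit of the matrix ring is exactly what rules out \<open>None\<close>, so the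
    unspecified value of \<open>inv_mat\<close> cannot occur here.\<close>
  have "A \<in> Units (ring_mat TYPE(real) n ())"
    by (rule det_non_zero_imp_unit[OF A det])
  then obtain C where "mat_inverse A = Some C"
    using mat_inverse(1)[OF A, of "()"] by (cases "mat_inverse A") auto
  with mat_inverse(2)[OF A this]
  show "inv_mat A \<in> carrier_mat n n" "A * inv_mat A = 1\<^sub>m n" "inv_mat A * A = 1\<^sub>m n"
    by (auto simp: inv_mat_def)
qed

lemma invertible_mat_det:
  fixes A :: "real mat"
  assumes A: "A \<in> carrier_mat n n" and inv: "invertible_mat A"
  shows "det A \<noteq> 0"
proof -
  obtain C where C: "A * C = 1\<^sub>m n" "C * A = 1\<^sub>m (dim_row C)"
    using A inv by (auto simp: invertible_mat_def inverts_mat_def)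
  \<comment> \<open>\<open>inverts_mat\<close> does not fix the shape of \<open>C\<close>; comparing
    the column counts in both equations does.\<close>
  have "C \<in> carrier_mat n n"
    using arg_cong[OF C(1), of dim_col] arg_cong[OF C(2), of dim_col] A by auto
  then have "det A * det C = 1"
    using det_mult[OF A, of C] C(1) by simp
  then show ?thesis
    by auto
qed

text \<open>A nonzero kernel vector would give the form the value 0.\<close>

lemma spd_det:
  assumes "sym_pos_def n R"
  shows "det R \<noteq> 0"
proof
  assume "det R = 0"
  moreover have "R \<in> carrier_mat n n"
    using assms by (simp add: sym_pos_def_def)
  ultimately obtain v where v: "v \<in> carrier_vec n" "v \<noteq> 0\<^sub>v n" "R *\<^sub>v v = 0\<^sub>v n"
    using det_0_iff_vec_prod_zero by blast
  then have "quad_form R v = 0"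
    by (simp add: quad_form_def)
  then show False
    using assms v unfolding sym_pos_def_def by force
qed

section \<open>The interior of an ellipsoid\<close>

lemma abs_index_le_norm:
  fixes d :: "real vec"
  assumes "d \<in> carrier_vec n" "i < n"
  shows "\<bar>d $ i\<bar> \<le> sqrt (d \<bullet> d)"
proof (rule real_le_rsqrt)
  have "(d $ i)\<^sup>2 \<le> (\<Sum>j<n. (d $ j)\<^sup>2)"
    using assms by (intro member_le_sum) auto
  also have "\<dots> = d \<bullet> d"
    using assms by (simp add: scalar_prod_def power2_eq_square atLeast0LessThan)
  finally show "\<bar>d $ i\<bar>\<^sup>2 \<le> d \<bullet> d"
    by simp
qed

text \<open>Stretching an interior point slightly away from the origin stays inside the ellipsoid,
  which excludes form value 1 or more. Conversely, an explicit bound on the increase of the form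
  over a small ball takes the place of a continuity argument.\<close>

lemma interior_ellipsoid:
  assumes R: "sym_pos_def n R"
  shows "interior_vec n (ellipsoid n R) = {u \<in> carrier_vec n. quad_form R u < 1}"
proof (intro equalityI subsetI)
  have Rc: "R \<in> carrier_mat n n"
    using R by (simp add: sym_pos_def_def)
  {
    fix u assume "u \<in> interior_vec n (ellipsoid n R)"
    then obtain e where u: "u \<in> carrier_vec n" and e: "0 < e"
      and ball: "\<And>v. v \<in> carrier_vec n \<Longrightarrow> sqrt ((v - u) \<bullet> (v - u)) < e \<Longrightarrow> quad_form R v \<le> 1"
      by (auto simp: interior_vec_def ellipsoid_def)
    let ?r = "sqrt (u \<bullet> u)"
    \<comment> \<open>The displacement \<open>t * ?r\<close> is then below \<open>e\<close>, and
      \<open>t\<close> is well defined and positive even for \<open>u = 0\<close>.\<close>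
    define t where "t = e / (?r + 1)"
    have r: "0 \<le> ?r"
      using scalar_prod_self_nonneg[of u] by simp
    have t: "0 < t"
      unfolding t_def using e r by (intro divide_pos_pos add_nonneg_pos) auto
    let ?v = "(1 + t) \<cdot>\<^sub>v u"
    have "?v - u = t \<cdot>\<^sub>v u"
      using u by (intro eq_vecI) (auto simp: algebra_simps)
    then have "sqrt ((?v - u) \<bullet> (?v - u)) = t * ?r"
      using u t by (simp add: real_sqrt_mult power2_eq_square[symmetric] mult.assoc[symmetric])
    also have "\<dots> < e"
    proof -
      have "0 < ?r + 1"
        using r by (rule add_nonneg_pos) simp
      moreover have "e * ?r < e * (?r + 1)"
        using e by simp
      ultimately show ?thesis
        by (simp add: t_def pos_divide_less_eq)
    qed
    finally have le: "(1 + t)\<^sup>2 * quad_form R u \<le> 1"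
      using ball[of ?v] u quad_form_smult[OF Rc u] by simp
    have less: "1 < (1 + t)\<^sup>2"
      using t by (simp add: power2_eq_square algebra_simps add_pos_pos)
    have "quad_form R u < 1"
    proof (rule ccontr)
      assume "\<not> quad_form R u < 1"
      then have "(1 + t)\<^sup>2 * 1 \<le> (1 + t)\<^sup>2 * quad_form R u"
        by (intro mult_left_mono) auto
      with le less show False
        by simp
    qed
    then show "u \<in> {u \<in> carrier_vec n. quad_form R u < 1}"
      using u by simp
  next
    fix u assume "u \<in> {u \<in> carrier_vec n. quad_form R u < 1}"
    then have u: "u \<in> carrier_vec n" "quad_form R u < 1"
      by auto
    \<comment> \<open>\<open>e * C\<close> will bound the increase of the form when every coordinate
      moves by at most \<open>e\<close>.\<close>
    define C where "C = (\<Sum>i<n. \<Sum>j<n. \<bar>R $$ (i, j)\<bar> * (\<bar>u $ i\<bar> + \<bar>u $ j\<bar> + 1))"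
    have C: "0 \<le> C"
      unfolding C_def by (intro sum_nonneg) auto
    \<comment> \<open>The bound \<open>e \<le> 1\<close> lets the product of two coordinate
      differences be estimated by \<open>e * 1\<close>, so that the whole increase is linear in
      \<open>e\<close>. The second bound makes this increase at most
      \<open>1 - quad_form R u\<close>.\<close>
    define e where "e = min 1 ((1 - quad_form R u) / (C + 1))"
    have e: "0 < e" "e \<le> 1" "e * (C + 1) \<le> 1 - quad_form R u"
    proof -
      have "e \<le> (1 - quad_form R u) / (C + 1)"
        by (simp add: e_def)
      then show "e * (C + 1) \<le> 1 - quad_form R u"
        using C by (simp add: pos_le_divide_eq)
    qed (use C u in \<open>auto simp: e_def\<close>)
    have "quad_form R v \<le> 1" if v: "v \<in> carrier_vec n" and d: "sqrt ((v - u) \<bullet> (v - u)) < e" for v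
    proof -
      have quad: "quad_form R x = (\<Sum>i<n. \<Sum>j<n. R $$ (i, j) * (x $ i * x $ j))"
        if x: "x \<in> carrier_vec n" for x
      proof -
        have "vec n (\<lambda>i. x $ i) = x"
          using x by auto
        then show ?thesis
          using quad_form_vec[OF Rc, of "\<lambda>i. x $ i"] by (simp add: sum_distrib_left algebra_simps)
      qed
      have d': "\<bar>v $ i - u $ i\<bar> \<le> e" if "i < n" for i
        using abs_index_le_norm[of "v - u" n i] u v d that by simp
      have "quad_form R v - quad_form R u
          = (\<Sum>i<n. \<Sum>j<n. R $$ (i, j) * (v $ i * v $ j - u $ i * u $ j))"
        using quad[OF v] quad[OF u(1)] by (simp add: sum_subtractf algebra_simps)
      also have "\<dots> \<le> (\<Sum>i<n. \<Sum>j<n. \<bar>R $$ (i, j)\<bar> * (e * (\<bar>u $ i\<bar> + \<bar>u $ j\<bar> + 1)))"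
      proof (intro sum_mono)
        fix i j assume ij: "i \<in> {..<n}" "j \<in> {..<n}"
        let ?di = "v $ i - u $ i" and ?dj = "v $ j - u $ j"
        have di: "\<bar>?di\<bar> \<le> e" and dj: "\<bar>?dj\<bar> \<le> e"
          using d' ij by auto
        have "v $ i * v $ j - u $ i * u $ j = u $ i * ?dj + ?di * u $ j + ?di * ?dj"
          by (simp add: algebra_simps)
        also have "\<bar>\<dots>\<bar> \<le> \<bar>u $ i\<bar> * \<bar>?dj\<bar> + \<bar>?di\<bar> * \<bar>u $ j\<bar> + \<bar>?di\<bar> * \<bar>?dj\<bar>"
          by (simp add: abs_mult[symmetric])
        also have "\<dots> \<le> \<bar>u $ i\<bar> * e + e * \<bar>u $ j\<bar> + e * 1"
          using di dj e by (intro add_mono mult_mono) auto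
        finally have "\<bar>v $ i * v $ j - u $ i * u $ j\<bar> \<le> e * (\<bar>u $ i\<bar> + \<bar>u $ j\<bar> + 1)"
          by (simp add: algebra_simps)
        then have le: "\<bar>R $$ (i, j)\<bar> * \<bar>v $ i * v $ j - u $ i * u $ j\<bar>
            \<le> \<bar>R $$ (i, j)\<bar> * (e * (\<bar>u $ i\<bar> + \<bar>u $ j\<bar> + 1))"
          by (intro mult_left_mono) auto
        have "R $$ (i, j) * (v $ i * v $ j - u $ i * u $ j)
            \<le> \<bar>R $$ (i, j) * (v $ i * v $ j - u $ i * u $ j)\<bar>"
          by (rule abs_ge_self)
        with le show "R $$ (i, j) * (v $ i * v $ j - u $ i * u $ j)
            \<le> \<bar>R $$ (i, j)\<bar> * (e * (\<bar>u $ i\<bar> + \<bar>u $ j\<bar> + 1))"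
          unfolding abs_mult by (rule order_trans[rotated])
      qed
      also have "\<dots> = e * C"
        by (simp add: C_def sum_distrib_left mult.left_commute)
      finally show ?thesis
        using e by (simp add: algebra_simps)
    qed
    then show "u \<in> interior_vec n (ellipsoid n R)"
      using u e by (auto simp: interior_vec_def ellipsoid_def)
  }
qed

section \<open>The largest generalized eigenvalue\<close>

text \<open>The sphere is modelled by functions vanishing from \<open>n\<close> on, since functions
  carry the product topology. It is closed, being cut out by equations in finitely many coordinates
  each, and lies in a cube that is compact by Tychonoff's theorem.\<close>

lemma compact_unit_sphere_fun:
  "compact {f :: nat \<Rightarrow> real. (\<forall>i\<ge>n. f i = 0) \<and> (\<Sum>i<n. f i * f i) = 1}" (is "compact ?S")
proof -
  have "compactin (product_topology (\<lambda>i :: nat. euclidean :: real topology) UNIV) (PiE UNIV (\<lambda>i. {-1..1}))"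
    by (subst compactin_PiE) auto
  then have K: "compact (PiE (UNIV :: nat set) (\<lambda>i. {-1..1 :: real}))"
    by (simp only: euclidean_product_topology compactin_euclidean_iff)
  have cont: "continuous_on UNIV (\<lambda>f :: nat \<Rightarrow> real. f i)" for i
    by simp
  have "?S = (\<Inter>i\<in>{n..}. {f. f i = 0}) \<inter> {f. (\<Sum>i<n. f i * f i) = 1}"
    by auto
  then have "closed ?S"
    by (auto intro!: closed_Int closed_INT closed_Collect_eq continuous_intros cont)
  moreover have "?S \<subseteq> PiE (UNIV :: nat set) (\<lambda>i. {-1..1})"
  proof
    fix f assume f: "f \<in> ?S"
    have "\<bar>f i\<bar> \<le> 1" for i
    proof (cases "i < n")
      case True
      have "f i * f i \<le> (\<Sum>i<n. f i * f i)"
        using True by (intro member_le_sum) auto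
      then have "(f i)\<^sup>2 \<le> 1"
        using f by (simp add: power2_eq_square)
      then show ?thesis
        by (simp add: abs_square_le_1)
    qed (use f in auto)
    then show "f \<in> PiE UNIV (\<lambda>i. {-1..1})"
      by (auto simp: abs_le_iff minus_le_iff)
  qed
  ultimately show ?thesis
    using compact_Int_closed[OF K, of ?S] by (simp add: Int_absorb1)
qed

text \<open>The maximiser is sought on the Euclidean unit sphere, as this is compact without any
  quantitative lower bound for \<open>quad_form R\<close>.\<close>

lemma rayleigh_quotient_attains_max:
  assumes n: "0 < n" and R: "sym_pos_def n R" and P: "P \<in> carrier_mat n n"
  obtains v where "v \<in> carrier_vec n" "v \<noteq> 0\<^sub>v n"
    "\<And>x. x \<in> carrier_vec n \<Longrightarrow>
      quad_form P x \<le> quad_form P v / quad_form R v * quad_form R x"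
proof -
  let ?S = "{f :: nat \<Rightarrow> real. (\<forall>i\<ge>n. f i = 0) \<and> (\<Sum>i<n. f i * f i) = 1}"
  let ?q = "\<lambda>f. quad_form P (vec n f) / quad_form R (vec n f)"
  have Rc: "R \<in> carrier_mat n n"
    using R by (simp add: sym_pos_def_def)
  have pos: "0 < quad_form R v" if "v \<in> carrier_vec n" "v \<noteq> 0\<^sub>v n" for v
    using R that by (simp add: sym_pos_def_def)
  have nz: "vec n f \<noteq> 0\<^sub>v n" if f: "f \<in> ?S" for f
  proof
    assume "vec n f = 0\<^sub>v n"
    then have "f i = 0" if "i < n" for i
      using that by (metis index_vec index_zero_vec(1))
    then show False
      using f by simp
  qed
  have cont: "continuous_on ?S (\<lambda>f :: nat \<Rightarrow> real. f i)" for i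
    by (rule continuous_on_subset[OF continuous_on_product_coordinates]) auto
  have "continuous_on ?S ?q"
  proof (rule continuous_on_divide)
    show "continuous_on ?S (\<lambda>f. quad_form P (vec n f))" "continuous_on ?S (\<lambda>f. quad_form R (vec n f))"
      unfolding quad_form_vec[OF P] quad_form_vec[OF Rc] by (intro continuous_intros cont)+
    show "\<forall>f\<in>?S. quad_form R (vec n f) \<noteq> 0"
    proof
      fix f assume "f \<in> ?S"
      then have "0 < quad_form R (vec n f)"
        by (intro pos nz) simp_all
      then show "quad_form R (vec n f) \<noteq> 0"
        by simp
    qed
  qed
  moreover have "?S \<noteq> {}"
  proof
    \<comment> \<open>The first unit vector, available because \<open>0 < n\<close>.\<close>
    have "(\<lambda>i. if i = 0 then 1 else 0) \<in> ?S"
      using n by (simp add: if_distrib[of "\<lambda>x. x * x"] cong: if_cong)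
    moreover assume "?S = {}"
    ultimately show False
      by (simp only: empty_iff)
  qed
  ultimately have "\<exists>f\<in>?S. \<forall>g\<in>?S. ?q g \<le> ?q f"
    by (intro continuous_attains_sup compact_unit_sphere_fun)
  then obtain f where f: "f \<in> ?S" and max: "\<forall>g\<in>?S. ?q g \<le> ?q f"
    by (rule bexE)
  show thesis
  proof
    show "vec n f \<in> carrier_vec n" "vec n f \<noteq> 0\<^sub>v n"
      using nz[OF f] by auto
    fix x :: "real vec" assume x: "x \<in> carrier_vec n"
    show "quad_form P x \<le> ?q f * quad_form R x"
    proof (cases "x = 0\<^sub>v n")
      case True
      then show ?thesis
        using P Rc by (simp add: quad_form_def)
    next
      case False
      \<comment> \<open>Scaling by \<open>c\<close> moves \<open>x\<close> onto the Euclidean unit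
        sphere, and the factor \<open>c^2\<close> cancels in the quotient of the two forms.\<close>
      define c where "c = 1 / sqrt (x \<bullet> x)"
      define g where "g i = (if i < n then c * x $ i else 0)" for i
      have xx: "0 < x \<bullet> x"
        using False x scalar_prod_self_nonneg[of x] scalar_prod_self_eq_0_iff[OF x] by (simp add: less_le)
      then have c: "0 < c" "c * c * (x \<bullet> x) = 1"
        by (auto simp: c_def)
      have "(\<Sum>i<n. g i * g i) = c * c * (x \<bullet> x)"
        using x by (simp add: g_def scalar_prod_def atLeast0LessThan sum_distrib_left algebra_simps)
      then have "g \<in> ?S"
        using c by (simp add: g_def)
      moreover have g: "vec n g = c \<cdot>\<^sub>v x"
        using x by (intro eq_vecI) (auto simp: g_def)
      ultimately have "(c\<^sup>2 * quad_form P x) / (c\<^sup>2 * quad_form R x) \<le> ?q f"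
        using bspec[OF max, of g] quad_form_smult[OF P x] quad_form_smult[OF Rc x] by simp
      then have "quad_form P x / quad_form R x \<le> ?q f"
        using c by simp
      then show ?thesis
        using pos[OF x False] by (simp add: pos_divide_le_eq)
    qed
  qed
qed

text \<open>Let \<open>l\<close> be the largest value of the quotient, attained at \<open>v\<close>.
  The form of \<open>S = l R - P\<close> is nonnegative and vanishes at \<open>v\<close>, hence
  \<open>S v = 0\<close>, that is \<open>P v = l R v\<close>, the eigenvector equation of
  \<open>A\<close>. Every eigenvalue is the value of the quotient at its eigenvector, so none
  exceeds \<open>l\<close>.\<close>

lemma max_generalized_eigenvector:
  assumes n: "0 < n" and R: "sym_pos_def n R" and P: "P \<in> carrier_mat n n" "P\<^sup>T = P"
  defines "A \<equiv> inv_mat R * P"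
  obtains v where "eigenvector A v (Max (spectrum A))" "quad_form R v = 1"
    "\<And>x. x \<in> carrier_vec n \<Longrightarrow> quad_form P x \<le> quad_form P v * quad_form R x"
proof -
  have Rc: "R \<in> carrier_mat n n" "R\<^sup>T = R"
    using R by (auto simp: sym_pos_def_def)
  note Ri = inv_mat_det[OF Rc(1) spd_det[OF R]]
  have A: "A \<in> carrier_mat n n"
    using Ri(1) P by (simp add: A_def)
  obtain v where v: "v \<in> carrier_vec n" "v \<noteq> 0\<^sub>v n"
    and max: "\<And>x. x \<in> carrier_vec n \<Longrightarrow> quad_form P x \<le> quad_form P v / quad_form R v * quad_form R x"
    using rayleigh_quotient_attains_max[OF n R P(1)] by blast
  define l where "l = quad_form P v / quad_form R v"
  have rv: "0 < quad_form R v"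
    using R v by (simp add: sym_pos_def_def)
  define S where "S = l \<cdot>\<^sub>m R - P"
  have S: "S \<in> carrier_mat n n" "S\<^sup>T = S"
  proof -
    show "S \<in> carrier_mat n n"
      unfolding S_def by (rule minus_carrier_mat[OF P(1)])
    have "R $$ (j, i) = R $$ (i, j)" "P $$ (j, i) = P $$ (i, j)" if "i < n" "j < n" for i j
      using that Rc P by (metis carrier_matD index_transpose_mat(1))+
    then show "S\<^sup>T = S"
      using Rc(1) P(1) by (intro eq_matI) (auto simp: S_def)
  qed
  have Sx: "S *\<^sub>v x = l \<cdot>\<^sub>v (R *\<^sub>v x) - P *\<^sub>v x" if "x \<in> carrier_vec n" for x
    using that Rc P by (simp add: S_def minus_mult_distrib_mat_vec[of _ n n] smult_mat_mult_vec[of _ n n])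
  have qS: "quad_form S x = l * quad_form R x - quad_form P x" if x: "x \<in> carrier_vec n" for x
    using x Rc P by (simp add: quad_form_def Sx scalar_prod_minus_distrib[of _ n])
  have "S *\<^sub>v v = 0\<^sub>v n"
  proof (rule psd_quad_form_zero[OF S _ v(1)])
    show "0 \<le> quad_form S x" if "x \<in> carrier_vec n" for x
      using max[OF that] qS[OF that] by (simp add: l_def)
    show "quad_form S v = 0"
      using rv by (simp add: qS[OF v(1)] l_def)
  qed
  then have *: "l \<cdot>\<^sub>v (R *\<^sub>v v) - P *\<^sub>v v = 0\<^sub>v n"
    using Sx[OF v(1)] by simp
  have Pv: "P *\<^sub>v v = l \<cdot>\<^sub>v (R *\<^sub>v v)"
  proof (rule eq_vecI)
    fix i assume "i < dim_vec (l \<cdot>\<^sub>v (R *\<^sub>v v))"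
    then show "(P *\<^sub>v v) $ i = (l \<cdot>\<^sub>v (R *\<^sub>v v)) $ i"
      using arg_cong[OF *, of "\<lambda>x. x $ i"] Rc P by simp
  qed (use Rc P in auto)
  have "A *\<^sub>v v = inv_mat R *\<^sub>v (l \<cdot>\<^sub>v (R *\<^sub>v v))"
    using Ri(1) P v Pv by (simp add: A_def)
  also have "\<dots> = l \<cdot>\<^sub>v (inv_mat R *\<^sub>v (R *\<^sub>v v))"
    using Ri(1) Rc v by (intro mult_mat_vec) auto
  also have "\<dots> = l \<cdot>\<^sub>v v"
    using assoc_mult_mat_vec[OF Ri(1) Rc(1) v(1)] Ri(3) v by simp
  finally have ev: "eigenvector A v l"
    using A v by (simp add: eigenvector_def)
  have "\<mu> \<le> l" if mu: "\<mu> \<in> spectrum A" for \<mu>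
  proof -
    obtain w where w: "w \<in> carrier_vec n" "w \<noteq> 0\<^sub>v n" "A *\<^sub>v w = \<mu> \<cdot>\<^sub>v w"
      using mu A by (auto simp: spectrum_def eigenvalue_def eigenvector_def)
    \<comment> \<open>Multiplying the eigenvector equation by \<open>R\<close> and pairing it with
      \<open>w\<close> exhibits the eigenvalue as a quotient of the two forms.\<close>
    have "P *\<^sub>v w = R *\<^sub>v (A *\<^sub>v w)"
      using w P Rc Ri assoc_mult_mat_vec[OF Rc(1) Ri(1), of "P *\<^sub>v w"] by (simp add: A_def)
    also have "\<dots> = \<mu> \<cdot>\<^sub>v (R *\<^sub>v w)"
      using w Rc by (simp add: mult_mat_vec)
    finally have "quad_form P w = \<mu> * quad_form R w"
      using w Rc by (simp add: quad_form_def)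
    moreover have "0 < quad_form R w"
      using R w by (simp add: sym_pos_def_def)
    ultimately have "\<mu> * quad_form R w \<le> l * quad_form R w" "0 < quad_form R w"
      using max[OF w(1)] unfolding l_def by metis+
    then show ?thesis
      by (rule mult_right_le_imp_le)
  qed
  moreover have "l \<in> spectrum A"
    using ev by (auto simp: spectrum_def eigenvalue_def)
  ultimately have l: "Max (spectrum A) = l"
    using card_finite_spectrum(1)[OF A] by (intro Max_eqI) auto
  \<comment> \<open>Normalization with respect to \<open>R\<close>; the form of \<open>P\<close> at
    the rescaled vector is then \<open>l\<close> itself.\<close>
  define c where "c = 1 / sqrt (quad_form R v)"
  have c: "0 < c" "c\<^sup>2 * quad_form R v = 1"
    using rv by (auto simp: c_def power_divide)
  show thesis
  proof
    have "c \<cdot>\<^sub>v v \<noteq> 0\<^sub>v n"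
    proof
      assume "c \<cdot>\<^sub>v v = 0\<^sub>v n"
      then have "quad_form R (c \<cdot>\<^sub>v v) = 0"
        using Rc by (simp add: quad_form_def)
      then show False
        using quad_form_smult[OF Rc(1) v(1)] c by simp
    qed
    moreover have "A *\<^sub>v (c \<cdot>\<^sub>v v) = l \<cdot>\<^sub>v (c \<cdot>\<^sub>v v)"
      using ev A v by (simp add: eigenvector_def mult_mat_vec smult_smult_assoc mult.commute)
    ultimately show "eigenvector A (c \<cdot>\<^sub>v v) (Max (spectrum A))"
      using A v l by (simp add: eigenvector_def)
    show "quad_form R (c \<cdot>\<^sub>v v) = 1"
      using quad_form_smult[OF Rc(1) v(1)] c by simp
    have "quad_form P (c \<cdot>\<^sub>v v) = c\<^sup>2 * quad_form R v * l"
      using quad_form_smult[OF P(1) v(1)] rv by (simp add: l_def)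
    then show "quad_form P x \<le> quad_form P (c \<cdot>\<^sub>v v) * quad_form R x" if "x \<in> carrier_vec n" for x
      using max[OF that] c by (simp add: l_def)
  qed
qed

section \<open>The control of minimal cost\<close>

lemma append_cols_carrier [simp, intro]:
  assumes "A \<in> carrier_mat r n1" "C \<in> carrier_mat r n2"
  shows "append_cols A C \<in> carrier_mat r (n1 + n2)"
  using assms by (auto simp: append_cols_def)

lemma append_cols_mult_append_rows:
  assumes A: "A \<in> carrier_mat r n1" "C \<in> carrier_mat r n2"
    and X: "X \<in> carrier_mat n1 s" "Y \<in> carrier_mat n2 s"
  shows "append_cols A C * (X @\<^sub>r Y) = A * X + C * Y"
proof -
  \<comment> \<open>Both factors are four-block matrices with empty blocks; in the product all
    blocks except the upper left one have no rows or no columns.\<close>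
  have "append_cols A C * (X @\<^sub>r Y)
      = four_block_mat (A * X + C * Y) (A * 0\<^sub>m n1 0 + C * 0\<^sub>m n2 0)
          (0\<^sub>m 0 n1 * X + 0\<^sub>m 0 n2 * Y) (0\<^sub>m 0 n1 * 0\<^sub>m n1 0 + 0\<^sub>m 0 n2 * 0\<^sub>m n2 0)"
    unfolding append_cols_def append_rows_def using assms by (simp add: mult_four_block_mat[of _ r n1 _ n2 _ 0 _ _ s _ 0])
  also have "\<dots> = A * X + C * Y"
    using assms by (intro eq_matI) auto
  finally show ?thesis .
qed

lemma transpose_append_rows:
  assumes "X \<in> carrier_mat n1 s" "Y \<in> carrier_mat n2 s"
  shows "(X @\<^sub>r Y)\<^sup>T = append_cols (X\<^sup>T) (Y\<^sup>T)"
  unfolding append_cols_def append_rows_def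
  using assms by (subst transpose_four_block_mat[of _ n1 s _ 0 _ n2]) auto

text \<open>The inner dimension splits as \<open>s + 0\<close>, so the second summand of each block
  is a product through dimension 0 and vanishes.\<close>

lemma append_rows_mult_append_cols:
  assumes X: "X \<in> carrier_mat n1 s" "Y \<in> carrier_mat n2 s"
    and A: "A \<in> carrier_mat s r1" "C \<in> carrier_mat s r2"
  shows "(X @\<^sub>r Y) * append_cols A C = four_block_mat (X * A) (X * C) (Y * A) (Y * C)"
  unfolding append_cols_def append_rows_def using assms
  by (subst mult_four_block_mat[of _ n1 s _ 0 _ n2 _ _ r1 _ r2]) auto

lemma append_cols_parts:
  assumes "B \<in> carrier_mat n m" "n \<le> m"
  shows "append_cols (basic_part B) (nonbasic_part B) = B"
  using assms by (intro eq_matI) (auto simp: append_cols_def basic_part_def nonbasic_part_def)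

text \<open>\<open>K\<close> parametrises the kernel of \<open>B\<close>, and \<open>M_mat\<close> is chosen so that the columns of
  \<open>H_mat\<close> are orthogonal to this kernel with respect to \<open>R\<close>.\<close>

lemma H_mat_properties:
  assumes nm: "n \<le> m" and B: "B \<in> carrier_mat n m" and R: "sym_pos_def m R"
    and inv: "invertible_mat (basic_part B)"
  obtains K where "H_mat B R \<in> carrier_mat m n" "B * H_mat B R = 1\<^sub>m n"
    "K \<in> carrier_mat m (m - n)" "K\<^sup>T * R * H_mat B R = 0\<^sub>m (m - n) n"
    "\<And>d. d \<in> carrier_vec m \<Longrightarrow> B *\<^sub>v d = 0\<^sub>v n \<Longrightarrow> \<exists>z\<in>carrier_vec (m - n). d = K *\<^sub>v z"
proof -
  \<comment> \<open>For \<open>m = n\<close> the blocks of width or height \<open>k\<close> are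
    empty, and the computations below apply without a case distinction.\<close>
  define k where "k = m - n"
  have m: "n + k = m"
    using nm by (simp add: k_def)
  have dims: "dim_row B = n" "dim_col B - n = k"
    using B by (auto simp: k_def)
  define Bb where "Bb = basic_part B"
  define N where "N = nonbasic_part B"
  define Bi where "Bi = inv_mat Bb"
  have Bb: "Bb \<in> carrier_mat n n" and N: "N \<in> carrier_mat n k"
    using B by (auto simp: Bb_def N_def basic_part_def nonbasic_part_def k_def)
  have Bi: "Bi \<in> carrier_mat n n" "Bb * Bi = 1\<^sub>m n" "Bi * Bb = 1\<^sub>m n"
    using inv_mat_det[OF Bb invertible_mat_det[OF Bb]] inv by (auto simp: Bi_def Bb_def)
  have B_eq: "B = append_cols Bb N"
    using append_cols_parts[OF B nm] by (simp add: Bb_def N_def)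
  have Rc: "R \<in> carrier_mat m m" "R\<^sup>T = R"
    using R by (auto simp: sym_pos_def_def)
  \<comment> \<open>Solving \<open>B d = 0\<close> for the basic components gives \<open>K\<close>,
    with the nonbasic ones as parameters. \<open>E\<close> is the right inverse of \<open>B\<close>
    that sets the nonbasic components to 0, and \<open>J\<close> reads off the nonbasic
    components.\<close>
  define K where "K = - (Bi * N) @\<^sub>r 1\<^sub>m k"
  define E where "E = Bi @\<^sub>r 0\<^sub>m k n"
  define J where "J = append_cols (0\<^sub>m k n) (1\<^sub>m k :: real mat)"
  have BiN: "Bi * N \<in> carrier_mat n k"
    using Bi N by auto
  have mBiN: "- (Bi * N) \<in> carrier_mat n k"
    using BiN by auto
  have K: "K \<in> carrier_mat m k" and E: "E \<in> carrier_mat m n" and J: "J \<in> carrier_mat k m"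
    using Bi(1) BiN unfolding K_def E_def J_def m[symmetric] by (auto intro!: carrier_append_rows)
  have KT: "K\<^sup>T = append_cols (- (N\<^sup>T * Bi\<^sup>T)) (1\<^sub>m k)"
  proof -
    have "K\<^sup>T = append_cols ((- (Bi * N))\<^sup>T) ((1\<^sub>m k)\<^sup>T)"
      unfolding K_def using BiN by (intro transpose_append_rows) auto
    moreover have "(- (Bi * N))\<^sup>T = - (N\<^sup>T * Bi\<^sup>T)"
      using Bi(1) N BiN transpose_mult[OF Bi(1) N] transpose_uminus[of "Bi * N"] by simp
    ultimately show ?thesis
      by simp
  qed
  have JK: "J * K = 1\<^sub>m k"
    unfolding J_def K_def using mBiN left_mult_zero_mat[OF mBiN, of k]
    by (subst append_cols_mult_append_rows) auto
  have BE: "B * E = 1\<^sub>m n"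
    unfolding B_eq E_def using Bb N Bi by (subst append_cols_mult_append_rows) auto
  have BK: "B * K = 0\<^sub>m n k"
  proof -
    have "B * K = Bb * - (Bi * N) + N * 1\<^sub>m k"
      unfolding B_eq K_def using Bb N BiN by (subst append_cols_mult_append_rows) auto
    also have "Bb * - (Bi * N) = - (Bb * (Bi * N))"
      by (rule uminus_mult_right_mat) (use Bb BiN in auto)
    also have "Bb * (Bi * N) = N"
      using assoc_mult_mat[OF Bb Bi(1) N] Bi N by simp
    finally show ?thesis
      using N by (intro eq_matI) auto
  qed
  \<comment> \<open>Splits each control into a part determined by its image under \<open>B\<close>
    and a kernel part; if the image is 0, only the kernel part remains.\<close>
  have EB: "E * B + K * J = 1\<^sub>m m"
  proof -
    have "E * B = four_block_mat (1\<^sub>m n) (Bi * N) (0\<^sub>m k n) (0\<^sub>m k k)"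
      unfolding E_def B_eq using Bi Bb N by (subst append_rows_mult_append_cols) auto
    moreover have "K * J = four_block_mat (0\<^sub>m n n) (- (Bi * N)) (0\<^sub>m k n) (1\<^sub>m k)"
      unfolding K_def J_def
      using append_rows_mult_append_cols[OF mBiN one_carrier_mat zero_carrier_mat[of k n] one_carrier_mat]
      by (simp add: right_mult_zero_mat[OF mBiN] right_mult_one_mat[OF mBiN])
    ultimately show ?thesis
      using BiN m carrier_matD[OF Bi(1)] carrier_matD[OF N] by (intro eq_matI) auto
  qed
  \<comment> \<open>The Gram matrix of the kernel basis for the inner product of \<open>R\<close>.
    It is positive definite because \<open>J\<close> is a left inverse of \<open>K\<close>, so the
    inverse taken in \<open>M_mat\<close> is a genuine one.\<close>
  define Q where "Q = K\<^sup>T * R * K"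
  define M where "M = M_mat B R"
  have Q: "Q \<in> carrier_mat k k"
    using K Rc by (simp add: Q_def)
  have "sym_pos_def k Q"
    unfolding sym_pos_def_def
  proof (intro conjI ballI impI)
    show "Q \<in> carrier_mat k k"
      by (rule Q)
    show "Q\<^sup>T = Q"
    proof -
      have "Q\<^sup>T = K\<^sup>T * (K\<^sup>T * R)\<^sup>T"
        unfolding Q_def using K Rc by (intro transpose_mult) auto
      also have "(K\<^sup>T * R)\<^sup>T = R * K"
        using K Rc by (subst transpose_mult) auto
      finally show ?thesis
        using assoc_mult_mat[of "K\<^sup>T" k m R m K k] K Rc by (simp add: Q_def)
    qed
    fix z :: "real vec" assume z: "z \<in> carrier_vec k" "z \<noteq> 0\<^sub>v k"
    have "J *\<^sub>v (K *\<^sub>v z) = z"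
      using assoc_mult_mat_vec[OF J K z(1)] JK z by simp
    moreover have "J *\<^sub>v 0\<^sub>v m = 0\<^sub>v k"
      using J by (intro eq_vecI) auto
    ultimately have "K *\<^sub>v z \<noteq> 0\<^sub>v m"
      using z by auto
    then have "0 < quad_form R (K *\<^sub>v z)"
      using R K z by (simp add: sym_pos_def_def)
    also have "\<dots> = quad_form Q z"
    proof -
      have "quad_form Q z = z \<bullet> (K\<^sup>T *\<^sub>v (R *\<^sub>v (K *\<^sub>v z)))"
        using K Rc z by (simp add: quad_form_def Q_def assoc_mult_mat_vec[of _ k m _ k] assoc_mult_mat_vec[of _ m m _ k])
      also have "\<dots> = (K *\<^sub>v z) \<bullet> (R *\<^sub>v (K *\<^sub>v z))"
        using transpose_vec_mult_scalar[of "K\<^sup>T" k m "R *\<^sub>v (K *\<^sub>v z)" z] K Rc z by simp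
      finally show ?thesis
        by (simp add: quad_form_def)
    qed
    finally show "0 < quad_form Q z" .
  qed
  note Qi = inv_mat_det[OF Q spd_det[OF this]]
  \<comment> \<open>In the definition of \<open>M_mat\<close> the left factor is
    \<open>K\<^sup>T\<close> and the stacked matrices are \<open>K\<close> and \<open>E\<close>.
    Thus \<open>M\<close> solves the normal equations \<open>Q M = K\<^sup>T R E\<close>: the
    columns of \<open>K M\<close> are the \<open>R\<close>-orthogonal projections of those of
    \<open>E\<close> onto the kernel, and \<open>H\<close> subtracts them.\<close>
  have M_eq: "M = inv_mat Q * (K\<^sup>T * R * E)"
    unfolding M_def M_mat_def Let_def Q_def KT unfolding K_def E_def Bi_def Bb_def N_def dims ..
  have KRE: "K\<^sup>T * R * E \<in> carrier_mat k n"
    using K Rc E by auto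
  have M: "M \<in> carrier_mat k n"
    using Qi(1) KRE by (simp add: M_eq)
  have QM: "Q * M = K\<^sup>T * R * E"
    using assoc_mult_mat[OF Q Qi(1) KRE] Qi(2) left_mult_one_mat[OF KRE] by (simp add: M_eq)
  have KM: "K * M \<in> carrier_mat m n"
    using K M by auto
  define H where "H = H_mat B R"
  have H_eq: "H = E - K * M"
  proof -
    have "H = (Bi + Bi * N * M) @\<^sub>r (- M)"
      by (simp add: H_def H_mat_def Let_def M_def Bi_def Bb_def N_def)
    moreover have "K * M = (- (Bi * N) * M) @\<^sub>r M"
    proof -
      \<comment> \<open>An empty block is attached so that the block product rule applies to
        \<open>K * M\<close>.\<close>
      have 1: "M = append_cols M (0\<^sub>m k 0)"
        using M by (intro eq_matI) (auto simp: append_cols_def)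
      have "K * append_cols M (0\<^sub>m k 0)
          = four_block_mat (- (Bi * N) * M) (- (Bi * N) * 0\<^sub>m k 0) (1\<^sub>m k * M) (1\<^sub>m k * 0\<^sub>m k 0)"
        unfolding K_def using BiN M by (intro append_rows_mult_append_cols) auto
      then show ?thesis
        using M BiN right_mult_zero_mat[OF mBiN, of 0] carrier_matD(1)[OF Bi(1)]
        by (simp add: 1[symmetric] append_rows_def)
    qed
    moreover have "- (Bi * N) * M = - (Bi * N * M)"
      by (rule uminus_mult_left_mat) (use BiN M Bi N in auto)
    ultimately show ?thesis
      using Bi(1) BiN M N by (intro eq_matI) (auto simp: E_def append_rows_def)
  qed
  have H: "H \<in> carrier_mat m n"
    unfolding H_eq by (rule minus_carrier_mat[OF KM])
  have KR: "K\<^sup>T * R \<in> carrier_mat k m"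
    using K Rc by auto
  show thesis
  proof
    show "H_mat B R \<in> carrier_mat m n"
      using H by (simp add: H_def)
    have "B * H = B * E - B * K * M"
      using mult_minus_distrib_mat[OF B E KM] assoc_mult_mat[OF B K M] by (simp add: H_eq)
    also have "\<dots> = 1\<^sub>m n"
      using M by (intro eq_matI) (auto simp: BE BK)
    finally show "B * H_mat B R = 1\<^sub>m n"
      by (simp add: H_def)
    show "K \<in> carrier_mat m (m - n)"
      using K by (simp add: k_def)
    have "K\<^sup>T * R * H = K\<^sup>T * R * E - Q * M"
      using mult_minus_distrib_mat[OF KR E KM] assoc_mult_mat[OF KR K M] by (simp add: H_eq Q_def)
    also have "\<dots> = 0\<^sub>m k n"
      using KRE by (simp add: QM)
    finally show "K\<^sup>T * R * H_mat B R = 0\<^sub>m (m - n) n"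
      by (simp add: H_def k_def)
    fix d assume d: "d \<in> carrier_vec m" "B *\<^sub>v d = 0\<^sub>v n"
    have "d = (E * B + K * J) *\<^sub>v d"
      using d by (simp add: EB)
    also have "\<dots> = E *\<^sub>v (B *\<^sub>v d) + K *\<^sub>v (J *\<^sub>v d)"
      using d(1) E B K J by (simp add: add_mult_distrib_mat_vec[of _ m m])
    also have "\<dots> = K *\<^sub>v (J *\<^sub>v d)"
    proof -
      have "E *\<^sub>v 0\<^sub>v n = 0\<^sub>v m"
        using E by (intro eq_vecI) auto
      moreover have "K *\<^sub>v (J *\<^sub>v d) \<in> carrier_vec m"
        using d(1) K J by auto
      ultimately show ?thesis
        by (simp add: d(2))
    qed
    finally show "\<exists>z\<in>carrier_vec (m - n). d = K *\<^sub>v z"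
      using J d(1) by (auto simp: k_def)
  qed
qed

text \<open>This is Pythagoras for the inner product of \<open>R\<close>: a control \<open>u\<close>
  with \<open>B u = w\<close> differs from \<open>H w\<close> by a kernel vector \<open>K z\<close>
  orthogonal to \<open>H w\<close>, so its cost is that of \<open>H w\<close> plus the nonnegative
  cost of \<open>K z\<close>.\<close>

lemma Phi_mat_minimal_cost:
  assumes nm: "n \<le> m" and B: "B \<in> carrier_mat n m" and R: "sym_pos_def m R"
    and inv: "invertible_mat (basic_part B)"
  shows "Phi_mat B R \<in> carrier_mat n n" "(Phi_mat B R)\<^sup>T = Phi_mat B R"
    and "w \<in> carrier_vec n \<Longrightarrow>
      \<exists>u\<in>carrier_vec m. B *\<^sub>v u = w \<and> quad_form R u = quad_form (Phi_mat B R) w"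
    and "u \<in> carrier_vec m \<Longrightarrow> quad_form (Phi_mat B R) (B *\<^sub>v u) \<le> quad_form R u"
proof -
  obtain K where H: "H_mat B R \<in> carrier_mat m n" and BH: "B * H_mat B R = 1\<^sub>m n"
    and K: "K \<in> carrier_mat m (m - n)" and orth: "K\<^sup>T * R * H_mat B R = 0\<^sub>m (m - n) n"
    and ker: "\<And>d. d \<in> carrier_vec m \<Longrightarrow> B *\<^sub>v d = 0\<^sub>v n \<Longrightarrow> \<exists>z\<in>carrier_vec (m - n). d = K *\<^sub>v z"
    using H_mat_properties[OF assms] by blast
  let ?H = "H_mat B R"
  have Rc: "R \<in> carrier_mat m m" "R\<^sup>T = R"
    using R by (auto simp: sym_pos_def_def)
  show "Phi_mat B R \<in> carrier_mat n n"
    using H Rc by (simp add: Phi_mat_def)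
  have "(Phi_mat B R)\<^sup>T = ?H\<^sup>T * (?H\<^sup>T * R)\<^sup>T"
    unfolding Phi_mat_def using H Rc by (intro transpose_mult) auto
  also have "(?H\<^sup>T * R)\<^sup>T = R * ?H"
    using H Rc by (subst transpose_mult) auto
  finally show "(Phi_mat B R)\<^sup>T = Phi_mat B R"
    using assoc_mult_mat[of "?H\<^sup>T" n m R m ?H n] H Rc by (simp add: Phi_mat_def)
  have quad: "quad_form (Phi_mat B R) w = quad_form R (?H *\<^sub>v w)" if w: "w \<in> carrier_vec n" for w
  proof -
    have "quad_form (Phi_mat B R) w = w \<bullet> (?H\<^sup>T *\<^sub>v (R *\<^sub>v (?H *\<^sub>v w)))"
      using H Rc w by (simp add: quad_form_def Phi_mat_def assoc_mult_mat_vec[of _ n m _ n] assoc_mult_mat_vec[of _ m m _ n])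
    also have "\<dots> = (?H *\<^sub>v w) \<bullet> (R *\<^sub>v (?H *\<^sub>v w))"
      using transpose_vec_mult_scalar[of "?H\<^sup>T" n m "R *\<^sub>v (?H *\<^sub>v w)" w] H Rc w by simp
    finally show ?thesis
      by (simp add: quad_form_def)
  qed
  have BHw: "B *\<^sub>v (?H *\<^sub>v w) = w" if "w \<in> carrier_vec n" for w
    using assoc_mult_mat_vec[OF B H that] BH that by simp
  show "\<exists>u\<in>carrier_vec m. B *\<^sub>v u = w \<and> quad_form R u = quad_form (Phi_mat B R) w"
    if "w \<in> carrier_vec n"
    using that H BHw quad by (intro bexI[of _ "?H *\<^sub>v w"]) auto
  show "quad_form (Phi_mat B R) (B *\<^sub>v u) \<le> quad_form R u" if u: "u \<in> carrier_vec m"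
  proof -
    define w where "w = B *\<^sub>v u"
    define h where "h = ?H *\<^sub>v w"
    have w: "w \<in> carrier_vec n" and h: "h \<in> carrier_vec m"
      using B H u by (auto simp: w_def h_def)
    have "B *\<^sub>v (u - h) = w - B *\<^sub>v h"
      using mult_minus_distrib_mat_vec[OF B u h] by (simp add: w_def)
    also have "\<dots> = 0\<^sub>v n"
      using BHw[OF w] w by (simp add: h_def)
    finally obtain z where z: "z \<in> carrier_vec (m - n)" "u - h = K *\<^sub>v z"
      using ker[of "u - h"] u h by auto
    have Kz: "K *\<^sub>v z \<in> carrier_vec m"
      using K z by auto
    have "u = h + (u - h)"
      using u h by (intro eq_vecI) auto
    then have "quad_form R u = quad_form R h + 2 * ((K *\<^sub>v z) \<bullet> (R *\<^sub>v h)) + quad_form R (K *\<^sub>v z)"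
      using quad_form_add[OF Rc h Kz] z by simp
    moreover have "(K *\<^sub>v z) \<bullet> (R *\<^sub>v h) = 0"
    proof -
      have "(K *\<^sub>v z) \<bullet> (R *\<^sub>v h) = z \<bullet> (K\<^sup>T *\<^sub>v (R *\<^sub>v h))"
        using transpose_vec_mult_scalar[of "K\<^sup>T" "m - n" m "R *\<^sub>v h" z] K Rc z h by simp
      also have "K\<^sup>T *\<^sub>v (R *\<^sub>v h) = (K\<^sup>T * R * ?H) *\<^sub>v w"
        using K Rc H w by (simp add: h_def assoc_mult_mat_vec[of _ "m - n" m _ n] assoc_mult_mat_vec[of _ m m _ n])
      also have "\<dots> = 0\<^sub>v (m - n)"
        using w unfolding orth by (intro eq_vecI) auto
      finally show ?thesis
        using z by simp
    qed
    moreover have "0 \<le> quad_form R (K *\<^sub>v z)"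
      using quad_form_spd_nonneg[OF R Kz] .
    ultimately show ?thesis
      using quad[OF w] by (simp add: w_def h_def)
  qed
qed

section \<open>Reordering the controls\<close>

lemma reorder_cols_mult_vec:
  assumes p: "p permutes {..<m}" and B: "B \<in> carrier_mat n m" and u: "u \<in> carrier_vec m"
  shows "reorder_cols p B *\<^sub>v vec m (\<lambda>j. u $ p j) = B *\<^sub>v u"
proof (rule eq_vecI)
  fix i assume "i < dim_vec (B *\<^sub>v u)"
  then have i: "i < n"
    using B by simp
  have "(reorder_cols p B *\<^sub>v vec m (\<lambda>j. u $ p j)) $ i = (\<Sum>j<m. B $$ (i, p j) * u $ p j)"
    using i B by (simp add: reorder_cols_def scalar_prod_def atLeast0LessThan)
  also have "\<dots> = (\<Sum>j<m. B $$ (i, j) * u $ j)"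
    by (rule sum.permute[OF p, unfolded o_def, symmetric])
  also have "\<dots> = (B *\<^sub>v u) $ i"
    using i B u by (simp add: scalar_prod_def atLeast0LessThan)
  finally show "(reorder_cols p B *\<^sub>v vec m (\<lambda>j. u $ p j)) $ i = (B *\<^sub>v u) $ i" .
qed (use B in \<open>simp add: reorder_cols_def\<close>)

lemma quad_form_reorder:
  assumes p: "p permutes {..<m}" and R: "R \<in> carrier_mat m m" and u: "u \<in> carrier_vec m"
  shows "quad_form (reorder_rows_cols p R) (vec m (\<lambda>j. u $ p j)) = quad_form R u"
proof -
  have p_less: "p i < m" if "i < m" for i
    using permutes_in_image[OF p, of i] that by simp
  have "reorder_rows_cols p R \<in> carrier_mat m m"
    using R by (simp add: reorder_rows_cols_def)
  then have "quad_form (reorder_rows_cols p R) (vec m (\<lambda>j. u $ p j))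
      = (\<Sum>i<m. u $ p i * (\<Sum>j<m. R $$ (p i, p j) * u $ p j))"
    using R by (simp add: quad_form_vec) (simp add: reorder_rows_cols_def)
  \<comment> \<open>The permutation is removed from the inner sum first and from the outer one
    afterwards.\<close>
  also have "\<dots> = (\<Sum>i<m. u $ p i * (\<Sum>j<m. R $$ (p i, j) * u $ j))"
    by (intro sum.cong refl arg_cong2[of _ _ _ _ "(*)"] sum.permute[OF p, unfolded o_def, symmetric])
  also have "\<dots> = (\<Sum>i<m. u $ i * (\<Sum>j<m. R $$ (i, j) * u $ j))"
    by (rule sum.permute[OF p, unfolded o_def, symmetric])
  also have "\<dots> = quad_form R (vec m (\<lambda>i. u $ i))"
    by (simp add: quad_form_vec[OF R])
  also have "vec m (\<lambda>i. u $ i) = u"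
    using u by auto
  finally show ?thesis .
qed

lemma reorder_vec_surj:
  assumes p: "p permutes {..<m}" and v: "v \<in> carrier_vec m"
  shows "\<exists>u\<in>carrier_vec m. vec m (\<lambda>j. u $ p j) = v"
proof
  show "vec m (\<lambda>j. vec m (\<lambda>i. v $ Hilbert_Choice.inv p i) $ p j) = v"
    using v permutes_in_image[OF p] permutes_inverses(2)[OF p] by (intro eq_vecI) auto
qed simp

text \<open>Every vector is the reordering of some \<open>u\<close>, nonzero if the vector is, and
  the reordered form takes on it the value of the original form at \<open>u\<close>.\<close>

lemma spd_reorder:
  assumes p: "p permutes {..<m}" and R: "sym_pos_def m R"
  shows "sym_pos_def m (reorder_rows_cols p R)"
  unfolding sym_pos_def_def
proof (intro conjI ballI impI)
  have Rc: "R \<in> carrier_mat m m" "R\<^sup>T = R"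
    using R by (auto simp: sym_pos_def_def)
  show "reorder_rows_cols p R \<in> carrier_mat m m"
    using Rc by (simp add: reorder_rows_cols_def)
  have "p i < m" if "i < m" for i
    using permutes_in_image[OF p, of i] that by simp
  moreover have "R $$ (j, i) = R $$ (i, j)" if "i < m" "j < m" for i j
    using that Rc by (metis carrier_matD index_transpose_mat(1))
  ultimately show "(reorder_rows_cols p R)\<^sup>T = reorder_rows_cols p R"
    using Rc(1) by (intro eq_matI) (auto simp: reorder_rows_cols_def)
  fix v :: "real vec" assume v: "v \<in> carrier_vec m" "v \<noteq> 0\<^sub>v m"
  obtain u where u: "u \<in> carrier_vec m" "vec m (\<lambda>j. u $ p j) = v"
    using reorder_vec_surj[OF p v(1)] by blast
  have "u \<noteq> 0\<^sub>v m"
  proof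
    assume "u = 0\<^sub>v m"
    then have "vec m (\<lambda>j. u $ p j) = 0\<^sub>v m"
      using permutes_in_image[OF p] by (intro eq_vecI) simp_all
    then show False
      using u(2) v(2) by simp
  qed
  then have "0 < quad_form R u"
    using R u(1) by (simp add: sym_pos_def_def)
  then show "0 < quad_form (reorder_rows_cols p R) v"
    using quad_form_reorder[OF p Rc(1) u(1)] u(2) by simp
qed

section \<open>The eigenvector criterion for stabilizability\<close>

theorem theorem1:
  fixes n m :: nat and B R_w R_u \<Phi> :: "real mat" and p :: "nat \<Rightarrow> nat"
  assumes "n \<le> m"
    and "B \<in> carrier_mat n m"
    and "elements_mat B \<subseteq> \<rat>"
    and "vec_space.rank n B = n"
    and "sym_pos_def n R_w"
    and "sym_pos_def m R_u"
    and "admissible_order B p"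
    and "\<Phi> = Phi_mat (reorder_cols p B) (reorder_rows_cols p R_u)"
  shows "eps_stabilizable B (ellipsoid n R_w) (ellipsoid m R_u) \<longleftrightarrow>
    (\<forall>w. eigenvector (inv_mat R_w * \<Phi>) w (Max (spectrum (inv_mat R_w * \<Phi>)))
          \<and> quad_form R_w w = 1
       \<longrightarrow> quad_form \<Phi> w < 1)"
proof -
  note B = assms(2) and Rw = assms(5) and Ru = assms(6)
  have p: "p permutes {..<m}" and inv: "invertible_mat (basic_part (reorder_cols p B))"
    using assms(7) B by (auto simp: admissible_order_def)
  have Ruc: "R_u \<in> carrier_mat m m" and Rwc: "R_w \<in> carrier_mat n n"
    using Ru Rw by (auto simp: sym_pos_def_def)
  have Bp: "reorder_cols p B \<in> carrier_mat n m"
    using B by (simp add: reorder_cols_def)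
  note Phi = Phi_mat_minimal_cost[OF assms(1) Bp spd_reorder[OF p Ru] inv, folded assms(8)]
  \<comment> \<open>Carries the minimal cost back from the reordered controls to the original ones:
    reordering changes neither \<open>B u\<close> nor the cost.\<close>
  have cost: "(\<exists>u\<in>carrier_vec m. B *\<^sub>v u = w \<and> quad_form R_u u < 1) \<longleftrightarrow> quad_form \<Phi> w < 1"
    if w: "w \<in> carrier_vec n" for w
  proof
    assume "\<exists>u\<in>carrier_vec m. B *\<^sub>v u = w \<and> quad_form R_u u < 1"
    then obtain u where u: "u \<in> carrier_vec m" "B *\<^sub>v u = w" "quad_form R_u u < 1"
      by blast
    show "quad_form \<Phi> w < 1"
      using Phi(4)[of "vec m (\<lambda>j. u $ p j)"] reorder_cols_mult_vec[OF p B u(1)]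
        quad_form_reorder[OF p Ruc u(1)] u by simp
  next
    assume "quad_form \<Phi> w < 1"
    then obtain v where v: "v \<in> carrier_vec m" "reorder_cols p B *\<^sub>v v = w"
      "quad_form (reorder_rows_cols p R_u) v < 1"
      using Phi(3)[OF w] by auto
    obtain u where u: "u \<in> carrier_vec m" "vec m (\<lambda>j. u $ p j) = v"
      using reorder_vec_surj[OF p v(1)] by blast
    show "\<exists>u\<in>carrier_vec m. B *\<^sub>v u = w \<and> quad_form R_u u < 1"
      using reorder_cols_mult_vec[OF p B u(1)] quad_form_reorder[OF p Ruc u(1)] u v by auto
  qed
  have stab: "eps_stabilizable B (ellipsoid n R_w) (ellipsoid m R_u) \<longleftrightarrow>
      (\<forall>w\<in>ellipsoid n R_w. quad_form \<Phi> w < 1)"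
  proof -
    have dim: "dim_col B = m"
      using B by simp
    have "(\<exists>u\<in>interior_vec (dim_col B) (ellipsoid m R_u). B *\<^sub>v u = w) \<longleftrightarrow> quad_form \<Phi> w < 1"
      if "w \<in> ellipsoid n R_w" for w
    proof -
      have "w \<in> carrier_vec n"
        using that by (simp add: ellipsoid_def)
      from cost[OF this] show ?thesis
        unfolding dim interior_ellipsoid[OF Ru] by auto
    qed
    then show ?thesis
      by (simp add: eps_stabilizable_def)
  qed
  \<comment> \<open>Needed to multiply \<open>quad_form R_w w \<le> 1\<close> by the value of the
    form of \<open>\<Phi>\<close> at the maximiser.\<close>
  have nonneg: "0 \<le> quad_form \<Phi> w" if "w \<in> carrier_vec n" for w
    using Phi(3)[OF that] quad_form_spd_nonneg[OF spd_reorder[OF p Ru]] by metis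
  show ?thesis
    unfolding stab
  proof (intro iffI allI impI ballI)
    fix w
    assume all: "\<forall>w\<in>ellipsoid n R_w. quad_form \<Phi> w < 1"
      and w: "eigenvector (inv_mat R_w * \<Phi>) w (Max (spectrum (inv_mat R_w * \<Phi>))) \<and> quad_form R_w w = 1"
    have "w \<in> carrier_vec n"
      using w inv_mat_det(1)[OF Rwc spd_det[OF Rw]] by (auto simp: eigenvector_def)
    then show "quad_form \<Phi> w < 1"
      using all w by (simp add: ellipsoid_def)
  next
    fix w
    assume eig: "\<forall>w. eigenvector (inv_mat R_w * \<Phi>) w (Max (spectrum (inv_mat R_w * \<Phi>)))
        \<and> quad_form R_w w = 1 \<longrightarrow> quad_form \<Phi> w < 1"
      and "w \<in> ellipsoid n R_w"
    then have w: "w \<in> carrier_vec n" "quad_form R_w w \<le> 1"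
      by (auto simp: ellipsoid_def)
    show "quad_form \<Phi> w < 1"
    proof (cases "n = 0")
      \<comment> \<open>In dimension 0 there are no eigenvectors, so the criterion holds vacuously
        and \<open>Max\<close> is taken over an empty set; the claim holds because the form is an
        empty sum.\<close>
      case True
      then show ?thesis
        using w by (simp add: quad_form_def scalar_prod_def Phi(1)[THEN carrier_matD(1)])
    next
      case False
      then obtain v where v: "eigenvector (inv_mat R_w * \<Phi>) v (Max (spectrum (inv_mat R_w * \<Phi>)))"
        "quad_form R_w v = 1"
        "\<And>x. x \<in> carrier_vec n \<Longrightarrow> quad_form \<Phi> x \<le> quad_form \<Phi> v * quad_form R_w x"
        using max_generalized_eigenvector[OF _ Rw Phi(1,2)] by blast
      have "v \<in> carrier_vec n"
        using v(1) inv_mat_det(1)[OF Rwc spd_det[OF Rw]] by (auto simp: eigenvector_def)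
      then have "quad_form \<Phi> v * quad_form R_w w \<le> quad_form \<Phi> v * 1"
        using nonneg w(2) by (intro mult_left_mono) auto
      also have "\<dots> < 1"
        using eig v by auto
      finally show ?thesis
        using v(3)[OF w(1)] by simp
    qed
  qed
qed

end
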